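(* Let $M>0$ and assume that: (i) $\varphi$ is a continuous map from $[0,a]$ to $[0,a]$; (ii) $f$ is continuous on $\mathcal{D}_M$ and $|f(t,u,v)|\le M$ for all $(t,u,v)\in\mathcal{D}_M$; (iii) there are constants $L_1,L_2\ge 0$ such that $$|f(t,u_2,v_2)-f(t,u_1,v_1)|\le L_1|u_2-u_1|+L_2|v_2-v_1|\quad\text{for all }(t,u_i,v_i)\in\mathcal{D}_M\ (i=1,2);$$ (iv) $q:=(L_1+L_2)M_0<1$. Let $\psi_0\in C[0,a]$ with $\|\psi_0\|\le M$ (for example $\psi_0(t)=f(t,0,0)$), and for $k=0,1,2,\dots$ define $$u_k(t)=g(t)+\int_0^aG(t,s)\psi_k(s)\,ds,\qquad v_k(t)=g(\varphi(t))+\int_0^aG(\varphi(t),s)\psi_k(s)\,ds,$$ $$\psi_{k+1}(t)=f(t,u_k(t),v_k(t)).$$ Then this iterative method converges, and for every $k\ge 0$ $$\|u_k-u\|\le M_0p_kd,\qquad p_k=\frac{q^k}{1-q},\quad d=\|\psi_1-\psi_0\|,$$ where $u$ is the exact solution of the boundary value problem $$u'''(t)=f(t,u(t),u(\varphi(t))),\quad t\in[0,a],\qquad B_1[u]=b_1,\ B_2[u]=b_2,\ B_3[u]=b_3,$$ namely its unique solution in $C^3[0,a]$ satisfying $|u(t)|\le\|g\|+M_0M$ for all $t\in[0,a]$.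
   Context: Let $a>0$, $f:[0,a]\times\mathbb{R}\times\mathbb{R}\to\mathbb{R}$ a function and $\varphi:[0,a]\to[0,a]$. Let $\alpha_i,\beta_i,\gamma_i,b_i$ ($i=1,2,3$) be real numbers and define the boundary functionals $$B_1[u]=\alpha_1u(0)+\beta_1u'(0)+\gamma_1u''(0),\quad B_2[u]=\alpha_2u(0)+\beta_2u'(0)+\gamma_2u''(0),\quad B_3[u]=\alpha_3u(a)+\beta_3u'(a)+\gamma_3u''(a),$$ where the matrix $$\begin{pmatrix}\alpha_1&\beta_1&\gamma_1&0&0&0\\ \alpha_2&\beta_2&\gamma_2&0&0&0\\ 0&0&0&\alpha_3&\beta_3&\gamma_3\end{pmatrix}$$ has rank $3$. Assume that the homogeneous problem $u'''=0$, $B_1[u]=B_2[u]=B_3[u]=0$ has only the trivial solution. Let $G(t,s)$, $(t,s)\in[0,a]^2$, be the Green function of this problem, i.e. the continuous function such that for every $\psi\in C[0,a]$ the function $\int_0^aG(t,s)\psi(s)\,ds$ is the unique solution of $u'''=\psi$ on $[0,a]$ with $B_1[u]=B_2[u]=B_3[u]=0$. Let $g$ be the polynomial of degree at most $2$ with $B_i[g]=b_i$ ($i=1,2,3$). For $w\in C[0,a]$ put $\|w\|=\max_{0\le t\le a}|w(t)|$. Put $$M_0=\max_{0\le t\le a}\int_0^a|G(t,s)|\,ds,$$ $$\mathcal{D}_M=\{(t,u,v)\mid 0\le t\le a,\ |u|\le\|g\|+M_0M,\ |v|\le\|g\|+M_0M\}.$$ *)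

theory Defs
  imports "HOL-Analysis.Analysis" "HOL-Computational_Algebra.Polynomial"
begin

text \<open>Derivative relative to \<open>[0,a]\<close>, hence one-sided at the endpoints. For \<open>a > 0\<close> its value at a
  point of \<open>[0,a]\<close> depends only on the restriction of \<open>u\<close> to \<open>[0,a]\<close>.\<close>
definition deriv_on :: "real \<Rightarrow> (real \<Rightarrow> real) \<Rightarrow> real \<Rightarrow> real" where
  "deriv_on a u t = vector_derivative u (at t within {0..a})"

definition C3_on :: "real \<Rightarrow> (real \<Rightarrow> real) \<Rightarrow> bool" where
  "C3_on a u \<longleftrightarrow>
     (\<forall>k<3. (deriv_on a ^^ k) u differentiable_on {0..a}) \<and>
     continuous_on {0..a} ((deriv_on a ^^ 3) u)"

text \<open>For continuous \<open>w\<close> and \<open>a \<ge> 0\<close> the supremum is attained, so this is \<open>max \<bar>w t\<bar>\<close> over \<open>[0,a]\<close>;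
  \<open>Max\<close> is only meaningful for finite sets.\<close>
definition norm_C :: "real \<Rightarrow> (real \<Rightarrow> real) \<Rightarrow> real" where
  "norm_C a w = (SUP t\<in>{0..a}. \<bar>w t\<bar>)"

definition boundary_form ::
    "real \<Rightarrow> real \<Rightarrow> real \<Rightarrow> real \<Rightarrow> real \<Rightarrow> (real \<Rightarrow> real) \<Rightarrow> real" where
  "boundary_form a \<alpha> \<beta> \<gamma> c u = \<alpha> * u c + \<beta> * deriv_on a u c + \<gamma> * deriv_on a (deriv_on a u) c"

definition boundary_conds ::
    "real \<Rightarrow> real^3 \<Rightarrow> real^3 \<Rightarrow> real^3 \<Rightarrow> real^3 \<Rightarrow> (real \<Rightarrow> real) \<Rightarrow> bool" where
  "boundary_conds a \<alpha> \<beta> \<gamma> b u \<longleftrightarrow>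
     boundary_form a (\<alpha>$1) (\<beta>$1) (\<gamma>$1) 0 u = b$1 \<and>
     boundary_form a (\<alpha>$2) (\<beta>$2) (\<gamma>$2) 0 u = b$2 \<and>
     boundary_form a (\<alpha>$3) (\<beta>$3) (\<gamma>$3) a u = b$3"

definition boundary_matrix :: "real^3 \<Rightarrow> real^3 \<Rightarrow> real^3 \<Rightarrow> real^6^3" where
  "boundary_matrix \<alpha> \<beta> \<gamma> = vector
     [vector [\<alpha>$1, \<beta>$1, \<gamma>$1, 0, 0, 0],
      vector [\<alpha>$2, \<beta>$2, \<gamma>$2, 0, 0, 0],
      vector [0, 0, 0, \<alpha>$3, \<beta>$3, \<gamma>$3]]"

definition solves_linear_bvp ::
    "real \<Rightarrow> real^3 \<Rightarrow> real^3 \<Rightarrow> real^3 \<Rightarrow> real^3 \<Rightarrow> (real \<Rightarrow> real) \<Rightarrow> (real \<Rightarrow> real) \<Rightarrow> bool" where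
  "solves_linear_bvp a \<alpha> \<beta> \<gamma> b \<psi> u \<longleftrightarrow>
     C3_on a u \<and> (\<forall>t\<in>{0..a}. (deriv_on a ^^ 3) u t = \<psi> t) \<and> boundary_conds a \<alpha> \<beta> \<gamma> b u"

definition solves_bvp ::
    "real \<Rightarrow> real^3 \<Rightarrow> real^3 \<Rightarrow> real^3 \<Rightarrow> real^3 \<Rightarrow> (real \<Rightarrow> real \<Rightarrow> real \<Rightarrow> real) \<Rightarrow> (real \<Rightarrow> real)
       \<Rightarrow> (real \<Rightarrow> real) \<Rightarrow> bool" where
  "solves_bvp a \<alpha> \<beta> \<gamma> b f \<phi> u \<longleftrightarrow>
     C3_on a u \<and> (\<forall>t\<in>{0..a}. (deriv_on a ^^ 3) u t = f t (u t) (u (\<phi> t))) \<and>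
     boundary_conds a \<alpha> \<beta> \<gamma> b u"

text \<open>Functions on \<open>[0,a]\<close> are total functions here, so uniqueness means equality on \<open>[0,a]\<close>.\<close>
definition green_function ::
    "real \<Rightarrow> real^3 \<Rightarrow> real^3 \<Rightarrow> real^3 \<Rightarrow> (real \<Rightarrow> real \<Rightarrow> real) \<Rightarrow> bool" where
  "green_function a \<alpha> \<beta> \<gamma> G \<longleftrightarrow>
     continuous_on ({0..a} \<times> {0..a}) (\<lambda>(t, s). G t s) \<and>
     (\<forall>\<psi>. continuous_on {0..a} \<psi> \<longrightarrow>
        solves_linear_bvp a \<alpha> \<beta> \<gamma> 0 \<psi> (\<lambda>t. integral {0..a} (\<lambda>s. G t s * \<psi> s)) \<and>
        (\<forall>w. solves_linear_bvp a \<alpha> \<beta> \<gamma> 0 \<psi> w \<longrightarrow>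
           (\<forall>t\<in>{0..a}. w t = integral {0..a} (\<lambda>s. G t s * \<psi> s))))"

text \<open>As for \<open>norm_C\<close>, the supremum is a maximum when \<open>G\<close> is continuous on the square.\<close>
definition green_bound :: "real \<Rightarrow> (real \<Rightarrow> real \<Rightarrow> real) \<Rightarrow> real" where
  "green_bound a G = (SUP t\<in>{0..a}. integral {0..a} (\<lambda>s. \<bar>G t s\<bar>))"

definition box_D :: "real \<Rightarrow> real \<Rightarrow> (real \<times> real \<times> real) set" where
  "box_D a r = {(t, u, v). 0 \<le> t \<and> t \<le> a \<and> \<bar>u\<bar> \<le> r \<and> \<bar>v\<bar> \<le> r}"

end

theory Submission
  imports Defs
begin

text \<open>
  A continuous source \<open>\<psi>\<close> determines exactly one solution of \<open>u''' = \<psi>\<close> with the inhomogeneous boundary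
  data, namely \<open>T \<psi> = g + \<integral> G(\<cdot>,s) \<psi>(s) ds\<close> (the solution with homogeneous data given by the Green
  function plus the polynomial \<open>g\<close> carrying the data). The nonlinear problem is therefore equivalent to a fixed-point equation for the source,
  \<open>\<psi>(t) = f(t, (T \<psi>)(t), (T \<psi>)(\<phi>(t)))\<close>, and the iteration in the theorem is Picard iteration for it.

  Since \<open>T\<close> is affine, \<open>M0\<close> controls it in the supremum norm (\<open>green_integral_abs_le\<close>): a source bounded
  by \<open>M\<close> yields a \<open>T \<psi>\<close> that stays in the box on which \<open>f\<close> is well behaved, so all iterates remain
  bounded by \<open>M\<close>; and two sources at distance \<open>e\<close> are sent to functions at distance at most \<open>M0 e\<close>, which
  the Lipschitz condition turns into new sources at distance at most \<open>(L1 + L2) M0 e = q e\<close>. As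
  \<open>q < 1\<close>, successive sources differ by at most \<open>d q^k\<close>, so they converge uniformly with the geometric
  tail \<open>d q^k / (1 - q)\<close> (\<open>geometric_steps_uniform_limit\<close>); one more application of \<open>T\<close> gives the factor
  \<open>M0\<close> in the error estimate. Uniqueness is the same contraction estimate, applied to two solutions.
\<close>

section \<open>Derivatives on a closed interval\<close>

lemma deriv_on_eqI:
  assumes "a > 0" "t \<in> {0..a}" "(u has_vector_derivative u') (at t within {0..a})"
  shows "deriv_on a u t = u'"
  using assms unfolding deriv_on_def
  by (intro vector_derivative_within_closed_interval) auto

lemma differentiable_on_imp_has_deriv_on:
  assumes "u differentiable_on {0..a}" "t \<in> {0..a}"
  shows "(u has_vector_derivative deriv_on a u t) (at t within {0..a})"
  using assms unfolding deriv_on_def differentiable_on_def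
  by (simp add: vector_derivative_works)

text \<open>Iterated derivatives are only determined on \<open>[0,a]\<close>, so an explicit candidate for the first derivative
  cannot be substituted for \<open>deriv_on a u\<close> as a function. This lemma makes the substitution at all three
  levels at once.\<close>

lemma derivative_chain:
  assumes a: "a > 0"
    and d1: "\<And>t. t \<in> {0..a} \<Longrightarrow> (u has_vector_derivative u1 t) (at t within {0..a})"
    and d2: "\<And>t. t \<in> {0..a} \<Longrightarrow> (u1 has_vector_derivative u2 t) (at t within {0..a})"
    and d3: "\<And>t. t \<in> {0..a} \<Longrightarrow> (u2 has_vector_derivative u3 t) (at t within {0..a})"
    and c3: "continuous_on {0..a} u3"
  shows "C3_on a u"
    and "\<And>t. t \<in> {0..a} \<Longrightarrow> deriv_on a u t = u1 t"
    and "\<And>t. t \<in> {0..a} \<Longrightarrow> deriv_on a (deriv_on a u) t = u2 t"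
    and "\<And>t. t \<in> {0..a} \<Longrightarrow> (deriv_on a ^^ 3) u t = u3 t"
proof -
  have e1: "deriv_on a u t = u1 t" if "t \<in> {0..a}" for t
    using deriv_on_eqI[OF a that d1[OF that]] .
  have d2': "(deriv_on a u has_vector_derivative u2 t) (at t within {0..a})" if "t \<in> {0..a}" for t
    by (rule has_vector_derivative_transform[OF that _ d2[OF that]]) (simp add: e1)
  have e2: "deriv_on a (deriv_on a u) t = u2 t" if "t \<in> {0..a}" for t
    using deriv_on_eqI[OF a that d2'[OF that]] .
  have d3': "(deriv_on a (deriv_on a u) has_vector_derivative u3 t) (at t within {0..a})"
    if "t \<in> {0..a}" for t
    by (rule has_vector_derivative_transform[OF that _ d3[OF that]]) (simp add: e2)
  have e3: "(deriv_on a ^^ 3) u t = u3 t" if "t \<in> {0..a}" for t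
    using deriv_on_eqI[OF a that d3'[OF that]] by (simp add: numeral_3_eq_3)
  show "C3_on a u"
    unfolding C3_on_def
  proof (intro conjI allI impI)
    show "continuous_on {0..a} ((deriv_on a ^^ 3) u)"
      using c3 e3 by (subst continuous_on_cong[OF refl, of _ _ u3]) auto
  next
    fix k :: nat assume "k < 3"
    then consider "k = 0" | "k = 1" | "k = 2" by linarith
    then show "(deriv_on a ^^ k) u differentiable_on {0..a}"
      using differentiableI_vector[OF d1] differentiableI_vector[OF d2'] differentiableI_vector[OF d3']
      by cases (simp_all add: differentiable_on_def numeral_2_eq_2)
  qed
  show "deriv_on a u t = u1 t" "deriv_on a (deriv_on a u) t = u2 t" "(deriv_on a ^^ 3) u t = u3 t"
    if "t \<in> {0..a}" for t
    using that e1 e2 e3 by auto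
qed

lemma C3_on_derivatives:
  assumes "C3_on a u" "t \<in> {0..a}"
  shows "(u has_vector_derivative deriv_on a u t) (at t within {0..a})"
    and "(deriv_on a u has_vector_derivative deriv_on a (deriv_on a u) t) (at t within {0..a})"
    and "(deriv_on a (deriv_on a u) has_vector_derivative (deriv_on a ^^ 3) u t) (at t within {0..a})"
proof -
  have diff: "(deriv_on a ^^ k) u differentiable_on {0..a}" if "k < 3" for k
    using assms(1) that unfolding C3_on_def by blast
  show "(u has_vector_derivative deriv_on a u t) (at t within {0..a})"
    using differentiable_on_imp_has_deriv_on[OF diff[of 0] assms(2)] by simp
  show "(deriv_on a u has_vector_derivative deriv_on a (deriv_on a u) t) (at t within {0..a})"
    using differentiable_on_imp_has_deriv_on[OF diff[of 1] assms(2)] by simp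
  show "(deriv_on a (deriv_on a u) has_vector_derivative (deriv_on a ^^ 3) u t) (at t within {0..a})"
    using differentiable_on_imp_has_deriv_on[OF diff[of 2] assms(2)]
    by (simp add: numeral_2_eq_2 numeral_3_eq_3)
qed

lemma C3_on_imp_continuous_on:
  assumes "C3_on a u"
  shows "continuous_on {0..a} u"
  using C3_on_derivatives(1)[OF assms]
  by (meson continuous_on_eq_continuous_within has_vector_derivative_continuous)

section \<open>The linear boundary value problem\<close>

lemma solves_linear_bvp_add_scaled:
  assumes a: "a > 0"
    and u: "solves_linear_bvp a \<alpha> \<beta> \<gamma> b \<psi> u"
    and w: "solves_linear_bvp a \<alpha> \<beta> \<gamma> b' \<psi>' w"
  shows "solves_linear_bvp a \<alpha> \<beta> \<gamma> (b + c *\<^sub>R b') (\<lambda>t. \<psi> t + c * \<psi>' t) (\<lambda>t. u t + c * w t)"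
proof -
  have C: "C3_on a u" "C3_on a w"
    using u w by (auto simp: solves_linear_bvp_def)
  note D = C3_on_derivatives[OF C(1)] C3_on_derivatives[OF C(2)]
  have cont: "continuous_on {0..a} (\<lambda>t. (deriv_on a ^^ 3) u t + c * (deriv_on a ^^ 3) w t)"
    using C unfolding C3_on_def by (intro continuous_intros) auto
  note chain = derivative_chain[where u = "\<lambda>t. u t + c * w t"
      and ?u1.0 = "\<lambda>t. deriv_on a u t + c * deriv_on a w t"
      and ?u2.0 = "\<lambda>t. deriv_on a (deriv_on a u) t + c * deriv_on a (deriv_on a w) t"
      and ?u3.0 = "\<lambda>t. (deriv_on a ^^ 3) u t + c * (deriv_on a ^^ 3) w t", OF a _ _ _ cont]
  note chain = chain[OF has_vector_derivative_add[OF D(1) has_vector_derivative_mult_right[OF D(4)]]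
      has_vector_derivative_add[OF D(2) has_vector_derivative_mult_right[OF D(5)]]
      has_vector_derivative_add[OF D(3) has_vector_derivative_mult_right[OF D(6)]]]
  have form: "boundary_form a p q r t (\<lambda>t. u t + c * w t)
      = boundary_form a p q r t u + c * boundary_form a p q r t w" if "t \<in> {0..a}" for p q r t
    using chain(2,3) that by (simp add: boundary_form_def algebra_simps)
  have "0 \<in> {0..a}" "a \<in> {0..a}" using a by auto
  with form u w have "boundary_conds a \<alpha> \<beta> \<gamma> (b + c *\<^sub>R b') (\<lambda>t. u t + c * w t)"
    by (simp add: solves_linear_bvp_def boundary_conds_def)
  moreover have "(deriv_on a ^^ 3) (\<lambda>t. u t + c * w t) t = \<psi> t + c * \<psi>' t" if "t \<in> {0..a}" for t
    using chain(4) that u w by (simp add: solves_linear_bvp_def)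
  ultimately show ?thesis
    using chain(1) by (simp add: solves_linear_bvp_def)
qed

lemma quadratic_solves_linear_bvp:
  fixes g :: "real poly"
  assumes a: "a > 0" and deg: "degree g \<le> 2" and bc: "boundary_conds a \<alpha> \<beta> \<gamma> b (poly g)"
  shows "solves_linear_bvp a \<alpha> \<beta> \<gamma> b (\<lambda>t. 0) (poly g)"
proof -
  have D: "(poly p has_vector_derivative poly (pderiv p) t) (at t within S)" for p :: "real poly" and t S
    using poly_DERIV[of p t]
    by (simp add: has_real_derivative_iff_has_vector_derivative has_vector_derivative_at_within)
  have "degree (pderiv (pderiv g)) = 0"
    using deg by (simp add: degree_pderiv)
  then have z: "pderiv (pderiv (pderiv g)) = 0"
    by (simp add: pderiv_eq_0_iff)
  note chain = derivative_chain[where u = "poly g" and ?u1.0 = "poly (pderiv g)"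
      and ?u2.0 = "poly (pderiv (pderiv g))" and ?u3.0 = "poly (pderiv (pderiv (pderiv g)))",
      OF a D D D]
  show ?thesis
    unfolding solves_linear_bvp_def using chain(1,4) bc z by (simp add: continuous_on_poly)
qed

text \<open>Linearity carries the defining property of the Green function over to the boundary data of \<open>g\<close>.
  The converse direction is what turns an arbitrary solution of the nonlinear problem into a fixed point.\<close>

lemma green_representation:
  fixes g :: "real poly"
  assumes a: "a > 0" and green: "green_function a \<alpha> \<beta> \<gamma> G"
    and deg: "degree g \<le> 2" and bc: "boundary_conds a \<alpha> \<beta> \<gamma> b (poly g)"
    and cont: "continuous_on {0..a} \<psi>"
  shows "solves_linear_bvp a \<alpha> \<beta> \<gamma> b \<psi> (\<lambda>t. poly g t + integral {0..a} (\<lambda>s. G t s * \<psi> s))"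
    and "\<And>w t. solves_linear_bvp a \<alpha> \<beta> \<gamma> b \<psi> w \<Longrightarrow> t \<in> {0..a} \<Longrightarrow>
           w t = poly g t + integral {0..a} (\<lambda>s. G t s * \<psi> s)"
proof -
  note g = quadratic_solves_linear_bvp[OF a deg bc]
  have hom: "solves_linear_bvp a \<alpha> \<beta> \<gamma> 0 \<psi> (\<lambda>t. integral {0..a} (\<lambda>s. G t s * \<psi> s))"
    and uniq: "\<And>w t. solves_linear_bvp a \<alpha> \<beta> \<gamma> 0 \<psi> w \<Longrightarrow> t \<in> {0..a} \<Longrightarrow>
       w t = integral {0..a} (\<lambda>s. G t s * \<psi> s)"
    using green cont unfolding green_function_def by blast+
  show "solves_linear_bvp a \<alpha> \<beta> \<gamma> b \<psi> (\<lambda>t. poly g t + integral {0..a} (\<lambda>s. G t s * \<psi> s))"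
    using solves_linear_bvp_add_scaled[OF a g hom, of 1] by simp
  fix w t
  assume w: "solves_linear_bvp a \<alpha> \<beta> \<gamma> b \<psi> w" and t: "t \<in> {0..a}"
  have "solves_linear_bvp a \<alpha> \<beta> \<gamma> 0 \<psi> (\<lambda>t. w t - poly g t)"
    using solves_linear_bvp_add_scaled[OF a w g, of "-1"] by simp
  from uniq[OF this t] show "w t = poly g t + integral {0..a} (\<lambda>s. G t s * \<psi> s)"
    by simp
qed

section \<open>Supremum norm estimates\<close>

lemma abs_le_norm_C:
  assumes "continuous_on {0..a} w" "t \<in> {0..a}"
  shows "\<bar>w t\<bar> \<le> norm_C a w"
  unfolding norm_C_def
proof (rule cSUP_upper)
  have "compact ((\<lambda>t. \<bar>w t\<bar>) ` {0..a})"
    using assms(1) by (intro compact_continuous_image continuous_intros) auto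
  then show "bdd_above ((\<lambda>t. \<bar>w t\<bar>) ` {0..a})"
    by (simp add: compact_imp_bounded bounded_imp_bdd_above)
qed (use assms in auto)

lemma norm_C_le:
  assumes "a \<ge> 0" "\<And>t. t \<in> {0..a} \<Longrightarrow> \<bar>w t\<bar> \<le> e"
  shows "norm_C a w \<le> e"
  unfolding norm_C_def using assms by (intro cSUP_least) auto

lemma kernel_section_continuous:
  assumes "continuous_on ({0..a} \<times> {0..a}) (\<lambda>(t, s). G t s)" "t \<in> {0..a::real}"
  shows "continuous_on {0..a} (G t)"
proof -
  have "continuous_on {0..a} (\<lambda>s. (t, s))"
    by (intro continuous_intros)
  moreover have "(\<lambda>s. (t, s)) ` {0..a} \<subseteq> {0..a} \<times> {0..a}"
    using assms(2) by auto
  ultimately show ?thesis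
    using continuous_on_compose2[OF assms(1), of "{0..a}" "\<lambda>s. (t, s)"] by simp
qed

lemma integral_abs_kernel_le_green_bound:
  assumes G: "continuous_on ({0..a} \<times> {0..a}) (\<lambda>(t, s). G t s)" and t: "t \<in> {0..a}"
  shows "integral {0..a} (\<lambda>s. \<bar>G t s\<bar>) \<le> green_bound a G"
  unfolding green_bound_def
proof (rule cSUP_upper[OF t])
  have "bounded ((\<lambda>(t, s). G t s) ` ({0..a} \<times> {0..a}))"
    using G by (intro compact_imp_bounded compact_continuous_image compact_Times) auto
  then obtain K where K: "\<And>t s. t \<in> {0..a} \<Longrightarrow> s \<in> {0..a} \<Longrightarrow> \<bar>G t s\<bar> \<le> K"
    unfolding bounded_iff by fastforce
  have "integral {0..a} (\<lambda>s. \<bar>G t s\<bar>) \<le> integral {0..a} (\<lambda>s. K)" if "t \<in> {0..a}" for t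
    using K[OF that] kernel_section_continuous[OF G that]
    by (intro integral_le integrable_continuous_real continuous_intros) auto
  then show "bdd_above ((\<lambda>t. integral {0..a} (\<lambda>s. \<bar>G t s\<bar>)) ` {0..a})"
    by (intro bdd_aboveI2)
qed

lemma green_bound_nonneg:
  assumes "a > 0" "continuous_on ({0..a} \<times> {0..a}) (\<lambda>(t, s). G t s)"
  shows "green_bound a G \<ge> 0"
proof -
  have "0 \<in> {0..a}" using assms(1) by simp
  have "0 \<le> integral {0..a} (\<lambda>s. \<bar>G 0 s\<bar>)"
    using kernel_section_continuous[OF assms(2) \<open>0 \<in> {0..a}\<close>]
    by (intro integral_nonneg integrable_continuous_real continuous_intros) auto
  also have "\<dots> \<le> green_bound a G"
    by (rule integral_abs_kernel_le_green_bound[OF assms(2) \<open>0 \<in> {0..a}\<close>])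
  finally show ?thesis .
qed

lemma green_integral_abs_le:
  assumes G: "continuous_on ({0..a} \<times> {0..a}) (\<lambda>(t, s). G t s)" and t: "t \<in> {0..a}"
    and cont: "continuous_on {0..a} \<psi>" and bound: "\<And>s. s \<in> {0..a} \<Longrightarrow> \<bar>\<psi> s\<bar> \<le> e"
  shows "\<bar>integral {0..a} (\<lambda>s. G t s * \<psi> s)\<bar> \<le> green_bound a G * e"
proof -
  note Gt = kernel_section_continuous[OF G t]
  have "\<bar>\<psi> t\<bar> \<le> e" using bound t by blast
  then have e: "e \<ge> 0" by linarith
  have "\<bar>integral {0..a} (\<lambda>s. G t s * \<psi> s)\<bar> \<le> integral {0..a} (\<lambda>s. \<bar>G t s\<bar> * e)"
    unfolding real_norm_def[symmetric]
    by (rule integral_norm_bound_integral)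
      (auto intro!: integrable_continuous_real continuous_intros Gt cont mult_left_mono bound
        simp: abs_mult)
  also have "\<dots> = integral {0..a} (\<lambda>s. \<bar>G t s\<bar>) * e"
    by simp
  also have "\<dots> \<le> green_bound a G * e"
    by (intro mult_right_mono integral_abs_kernel_le_green_bound G t e)
  finally show ?thesis .
qed

lemma green_integral_diff_abs_le:
  assumes G: "continuous_on ({0..a} \<times> {0..a}) (\<lambda>(t, s). G t s)" and t: "t \<in> {0..a}"
    and cont: "continuous_on {0..a} \<psi>" "continuous_on {0..a} \<eta>"
    and bound: "\<And>s. s \<in> {0..a} \<Longrightarrow> \<bar>\<psi> s - \<eta> s\<bar> \<le> e"
  shows "\<bar>integral {0..a} (\<lambda>s. G t s * \<psi> s) - integral {0..a} (\<lambda>s. G t s * \<eta> s)\<bar> \<le> green_bound a G * e"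
proof -
  note Gt = kernel_section_continuous[OF G t]
  have "integral {0..a} (\<lambda>s. G t s * \<psi> s) - integral {0..a} (\<lambda>s. G t s * \<eta> s)
      = integral {0..a} (\<lambda>s. G t s * (\<psi> s - \<eta> s))"
    unfolding right_diff_distrib
    by (intro integral_diff[symmetric] integrable_continuous_real continuous_intros Gt cont)
  then show ?thesis
    using green_integral_abs_le[OF G t continuous_on_diff[OF cont] bound] by simp
qed

section \<open>The nonlinear right-hand side and the iteration\<close>

text \<open>As \<open>\<phi>\<close> maps \<open>[0,a]\<close> into itself, a single bound on \<open>U\<close> controls both state arguments of \<open>f\<close>, so the
  hypotheses on \<open>f\<close> apply along the whole graph of \<open>U\<close>.\<close>

lemma delayed_superposition:
  assumes D: "D = box_D a r"
    and f_cont: "continuous_on D (\<lambda>(t, x, y). f t x y)"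
    and f_bound: "\<forall>(t, x, y)\<in>D. \<bar>f t x y\<bar> \<le> M"
    and phi: "continuous_on {0..a} \<phi>" "\<phi> ` {0..a} \<subseteq> {0..a}"
    and U: "continuous_on {0..a} U" "\<And>t. t \<in> {0..a} \<Longrightarrow> \<bar>U t\<bar> \<le> r"
  shows "\<And>t. t \<in> {0..a} \<Longrightarrow> (t, U t, U (\<phi> t)) \<in> D"
    and "continuous_on {0..a} (\<lambda>t. f t (U t) (U (\<phi> t)))"
    and "\<And>t. t \<in> {0..a} \<Longrightarrow> \<bar>f t (U t) (U (\<phi> t))\<bar> \<le> M"
proof -
  show in_D: "(t, U t, U (\<phi> t)) \<in> D" if "t \<in> {0..a}" for t
  proof -
    have "\<phi> t \<in> {0..a}" using phi(2) that by blast
    then show ?thesis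
      using that U(2)[OF that] U(2)[of "\<phi> t"] by (simp add: D box_D_def)
  qed
  have "continuous_on {0..a} (\<lambda>t. (t, U t, U (\<phi> t)))"
    by (intro continuous_intros U(1) continuous_on_compose2[OF U(1) phi])
  from continuous_on_compose2[OF f_cont this image_subsetI[OF in_D]]
  show "continuous_on {0..a} (\<lambda>t. f t (U t) (U (\<phi> t)))"
    by simp
  show "\<bar>f t (U t) (U (\<phi> t))\<bar> \<le> M" if "t \<in> {0..a}" for t
    using f_bound in_D[OF that] by auto
qed

text \<open>The telescoping series of the steps is dominated by a geometric series, whose tail from index \<open>k\<close> is
  the stated error bound.\<close>

lemma geometric_steps_uniform_limit:
  fixes x :: "nat \<Rightarrow> 'a \<Rightarrow> real"
  assumes q: "0 \<le> q" "q < 1"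
    and step: "\<And>k t. t \<in> S \<Longrightarrow> \<bar>x (Suc k) t - x k t\<bar> \<le> q ^ k * d"
  obtains X where "uniform_limit S x X sequentially"
    and "\<And>k t. t \<in> S \<Longrightarrow> \<bar>x k t - X t\<bar> \<le> q ^ k / (1 - q) * d"
proof -
  have geo: "(\<lambda>i. q ^ (i + k) * d) sums (q ^ k / (1 - q) * d)" for k
    using sums_mult2[OF geometric_sums, of q "q ^ k * d"] q by (simp add: power_add field_simps)
  define X where "X t = (\<Sum>i. x (Suc i) t - x i t) + x 0 t" for t
  have "uniform_limit S (\<lambda>n t. \<Sum>i<n. x (Suc i) t - x i t) (\<lambda>t. \<Sum>i. x (Suc i) t - x i t) sequentially"
    by (rule Weierstrass_m_test[OF _ sums_summable[OF geo[of 0]]]) (use step in auto)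
  moreover have "(\<Sum>i<n. x (Suc i) t - x i t) + x 0 t = x n t" for n t
    using sum_lessThan_telescope[of "\<lambda>i. x i t" n] by simp
  ultimately have lim: "uniform_limit S x X sequentially"
    using uniform_limit_add[OF _ uniform_limit_const[where c = "x 0"]]
    unfolding X_def by fastforce
  have "\<bar>x k t - X t\<bar> \<le> q ^ k / (1 - q) * d" if t: "t \<in> S" for k t
  proof -
    have "(\<lambda>n. x n t) \<longlonglongrightarrow> X t"
      using tendsto_uniform_limitI[OF lim t] .
    from telescope_sums[OF LIMSEQ_ignore_initial_segment[OF this, of k]]
    have S: "(\<lambda>i. x (Suc i + k) t - x (i + k) t) sums (X t - x k t)"
      by simp
    have "norm (\<Sum>i. x (Suc i + k) t - x (i + k) t) \<le> (\<Sum>i. q ^ (i + k) * d)"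
      using step[OF t] by (intro norm_suminf_le sums_summable[OF geo]) simp
    then show ?thesis
      using sums_unique[OF S] sums_unique[OF geo[of k]] by (simp add: abs_minus_commute)
  qed
  with lim show ?thesis by (rule that)
qed

theorem theorem3p1:
  fixes a M M0 L1 L2 q d :: real
    and f :: "real \<Rightarrow> real \<Rightarrow> real \<Rightarrow> real"
    and \<phi> :: "real \<Rightarrow> real"
    and \<alpha> \<beta> \<gamma> b :: "real^3"
    and G :: "real \<Rightarrow> real \<Rightarrow> real"
    and g :: "real poly"
    and D :: "(real \<times> real \<times> real) set"
    and \<psi> u v :: "nat \<Rightarrow> real \<Rightarrow> real"
  assumes a_pos: "a > 0"
    and rank3: "rank (boundary_matrix \<alpha> \<beta> \<gamma>) = 3"
    and trivial: "\<forall>w. solves_linear_bvp a \<alpha> \<beta> \<gamma> 0 (\<lambda>t. 0) w \<longrightarrow> (\<forall>t\<in>{0..a}. w t = 0)"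
    and green: "green_function a \<alpha> \<beta> \<gamma> G"
    and g_deg: "degree g \<le> 2"
    and g_bc: "boundary_conds a \<alpha> \<beta> \<gamma> b (poly g)"
    and M0_eq: "M0 = green_bound a G"
    and D_eq: "D = box_D a (norm_C a (poly g) + M0 * M)"
    and M_pos: "M > 0"
    and phi_cont: "continuous_on {0..a} \<phi>"
    and phi_maps: "\<phi> ` {0..a} \<subseteq> {0..a}"
    and f_cont: "continuous_on D (\<lambda>(t, x, y). f t x y)"
    and f_bound: "\<forall>(t, x, y)\<in>D. \<bar>f t x y\<bar> \<le> M"
    and L_nonneg: "L1 \<ge> 0" "L2 \<ge> 0"
    and f_lip: "\<forall>t x1 y1 x2 y2. (t, x1, y1) \<in> D \<longrightarrow> (t, x2, y2) \<in> D \<longrightarrow>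
       \<bar>f t x2 y2 - f t x1 y1\<bar> \<le> L1 * \<bar>x2 - x1\<bar> + L2 * \<bar>y2 - y1\<bar>"
    and q_eq: "q = (L1 + L2) * M0"
    and q_less: "q < 1"
    and psi0_cont: "continuous_on {0..a} (\<psi> 0)"
    and psi0_bound: "norm_C a (\<psi> 0) \<le> M"
    and u_eq: "\<forall>k. \<forall>t\<in>{0..a}. u k t = poly g t + integral {0..a} (\<lambda>s. G t s * \<psi> k s)"
    and v_eq: "\<forall>k. \<forall>t\<in>{0..a}. v k t = poly g (\<phi> t) + integral {0..a} (\<lambda>s. G (\<phi> t) s * \<psi> k s)"
    and psi_Suc: "\<forall>k. \<forall>t\<in>{0..a}. \<psi> (Suc k) t = f t (u k t) (v k t)"
    and d_eq: "d = norm_C a (\<lambda>t. \<psi> 1 t - \<psi> 0 t)"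
  shows "\<exists>U. solves_bvp a \<alpha> \<beta> \<gamma> b f \<phi> U \<and>
     (\<forall>t\<in>{0..a}. \<bar>U t\<bar> \<le> norm_C a (poly g) + M0 * M) \<and>
     (\<forall>w. solves_bvp a \<alpha> \<beta> \<gamma> b f \<phi> w \<and>
          (\<forall>t\<in>{0..a}. \<bar>w t\<bar> \<le> norm_C a (poly g) + M0 * M) \<longrightarrow> (\<forall>t\<in>{0..a}. w t = U t)) \<and>
     uniform_limit {0..a} u U sequentially \<and>
     (\<forall>k. norm_C a (\<lambda>t. u k t - U t) \<le> M0 * (q ^ k / (1 - q)) * d)"
proof -
  let ?r = "norm_C a (poly g) + M0 * M"
  let ?T = "\<lambda>\<eta> t. poly g t + integral {0..a} (\<lambda>s. G t s * \<eta> s)"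
  have G: "continuous_on ({0..a} \<times> {0..a}) (\<lambda>(t, s). G t s)"
    using green by (simp add: green_function_def)
  have M0: "M0 \<ge> 0" and q0: "q \<ge> 0"
    using green_bound_nonneg[OF a_pos G] L_nonneg by (simp_all add: M0_eq q_eq)
  note repr = green_representation[OF a_pos green g_deg g_bc]
  note super = delayed_superposition[OF D_eq f_cont f_bound phi_cont phi_maps]
  have phi_in: "\<phi> t \<in> {0..a}" if "t \<in> {0..a}" for t
    using phi_maps that by blast

  have T_cont: "continuous_on {0..a} (?T \<eta>)" if "continuous_on {0..a} \<eta>" for \<eta>
    using repr(1)[OF that] by (simp add: solves_linear_bvp_def C3_on_imp_continuous_on)
  have T_bound: "\<bar>?T \<eta> t\<bar> \<le> ?r"
    if "continuous_on {0..a} \<eta>" "\<And>s. s \<in> {0..a} \<Longrightarrow> \<bar>\<eta> s\<bar> \<le> M" "t \<in> {0..a}" for \<eta> t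
    using green_integral_abs_le[OF G that(3,1,2)]
      abs_le_norm_C[OF continuous_on_poly[OF continuous_on_id] that(3), of g]
    unfolding M0_eq by linarith
  have T_diff: "\<bar>?T \<eta> t - ?T \<omega> t\<bar> \<le> M0 * e"
    if "continuous_on {0..a} \<eta>" "continuous_on {0..a} \<omega>"
      "\<And>s. s \<in> {0..a} \<Longrightarrow> \<bar>\<eta> s - \<omega> s\<bar> \<le> e" "t \<in> {0..a}" for \<eta> \<omega> t e
    using green_integral_diff_abs_le[OF G that(4,1,2,3)] by (simp add: M0_eq)
  have f_diff: "\<bar>f t (x t) (x (\<phi> t)) - f t (y t) (y (\<phi> t))\<bar> \<le> (L1 + L2) * e"
    if "continuous_on {0..a} x" "\<And>s. s \<in> {0..a} \<Longrightarrow> \<bar>x s\<bar> \<le> ?r"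
      "continuous_on {0..a} y" "\<And>s. s \<in> {0..a} \<Longrightarrow> \<bar>y s\<bar> \<le> ?r"
      "\<And>s. s \<in> {0..a} \<Longrightarrow> \<bar>x s - y s\<bar> \<le> e" "t \<in> {0..a}" for x y t e
  proof -
    have "\<bar>f t (x t) (x (\<phi> t)) - f t (y t) (y (\<phi> t))\<bar>
        \<le> L1 * \<bar>x t - y t\<bar> + L2 * \<bar>x (\<phi> t) - y (\<phi> t)\<bar>"
      using f_lip super(1)[OF that(1,2,6)] super(1)[OF that(3,4,6)] by blast
    also have "\<dots> \<le> L1 * e + L2 * e"
      using that(5)[OF that(6)] that(5)[OF phi_in[OF that(6)]] L_nonneg
      by (intro add_mono mult_left_mono) auto
    finally show ?thesis by (simp add: distrib_right)
  qed

  have u_T: "u k t = ?T (\<psi> k) t" if "t \<in> {0..a}" for k t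
    using u_eq that by blast
  have psi_step: "\<psi> (Suc k) t = f t (u k t) (u k (\<phi> t))" if "t \<in> {0..a}" for k t
    using psi_Suc v_eq u_eq phi_in that by simp
  have u_cont: "continuous_on {0..a} (u k)" if "continuous_on {0..a} (\<psi> k)" for k
    using T_cont[OF that] by (subst continuous_on_cong[OF refl u_T])
  \<comment> \<open>The bound \<open>M\<close> keeps each \<open>u k\<close> in the box, which is what makes the next source continuous and
    again bounded by \<open>M\<close>.\<close>
  have psi: "continuous_on {0..a} (\<psi> k) \<and> (\<forall>t\<in>{0..a}. \<bar>\<psi> k t\<bar> \<le> M)" for k
  proof (induction k)
    case 0
    show ?case
      using psi0_cont psi0_bound abs_le_norm_C[OF psi0_cont] by (meson order_trans)
  next
    case (Suc k)
    then have c: "continuous_on {0..a} (u k)" and b: "\<And>t. t \<in> {0..a} \<Longrightarrow> \<bar>u k t\<bar> \<le> ?r"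
      using u_cont T_bound u_T by simp_all
    have "continuous_on {0..a} (\<psi> (Suc k))"
      using super(2)[OF c b] by (rule continuous_on_eq) (simp_all add: psi_step)
    moreover have "\<bar>\<psi> (Suc k) t\<bar> \<le> M" if "t \<in> {0..a}" for t
      using super(3)[OF c b that] psi_step[OF that] by simp
    ultimately show ?case by blast
  qed
  then have psi_cont: "continuous_on {0..a} (\<psi> k)"
    and psi_le: "t \<in> {0..a} \<Longrightarrow> \<bar>\<psi> k t\<bar> \<le> M" for k t
    by blast+
  note u_cont = u_cont[OF psi_cont]
  have u_bound: "\<bar>u k t\<bar> \<le> ?r" if "t \<in> {0..a}" for k t
    using T_bound[OF psi_cont psi_le that] u_T[OF that] by simp

  have step: "\<bar>\<psi> (Suc k) t - \<psi> k t\<bar> \<le> q ^ k * d" if "t \<in> {0..a}" for k t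
    using that
  proof (induction k arbitrary: t)
    case 0
    then show ?case
      using abs_le_norm_C[OF continuous_on_diff[OF psi_cont psi_cont]] by (simp add: d_eq)
  next
    case (Suc k)
    have "\<bar>u (Suc k) s - u k s\<bar> \<le> M0 * (q ^ k * d)" if "s \<in> {0..a}" for s
      using T_diff[OF psi_cont psi_cont Suc.IH that] u_T[OF that] by simp
    from f_diff[OF u_cont u_bound u_cont u_bound this Suc.prems]
    show ?case
      using psi_step[OF Suc.prems] by (simp add: q_eq algebra_simps)
  qed
  obtain \<Psi> where lim: "uniform_limit {0..a} \<psi> \<Psi> sequentially"
    and err: "\<And>k t. t \<in> {0..a} \<Longrightarrow> \<bar>\<psi> k t - \<Psi> t\<bar> \<le> q ^ k / (1 - q) * d"
    using geometric_steps_uniform_limit[of q "{0..a}" \<psi> d, OF q0 q_less step] by blast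
  have Psi_cont: "continuous_on {0..a} \<Psi>"
    using uniform_limit_theorem[OF _ lim] psi_cont by simp
  have Psi_le: "\<bar>\<Psi> t\<bar> \<le> M" if "t \<in> {0..a}" for t
    using tendsto_rabs[OF tendsto_uniform_limitI[OF lim that]] psi_le[OF that]
    by (intro LIMSEQ_le_const2) auto

  \<comment> \<open>The solution is obtained from the limit source, not as a limit of the \<open>u k\<close>: uniform convergence alone
    would give no control over three derivatives, whereas \<open>T \<Psi>\<close> is \<open>C\<^sup>3\<close> by the property of \<open>G\<close>.\<close>
  define U where "U = ?T \<Psi>"
  have U_cont: "continuous_on {0..a} U"
    using T_cont[OF Psi_cont] by (simp add: U_def)
  have U_bound: "\<bar>U t\<bar> \<le> ?r" if "t \<in> {0..a}" for t
    using T_bound[OF Psi_cont Psi_le that] by (simp add: U_def)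
  have u_err: "\<bar>u k t - U t\<bar> \<le> M0 * (q ^ k / (1 - q) * d)" if "t \<in> {0..a}" for k t
    using T_diff[OF psi_cont Psi_cont err that] u_T[OF that] by (simp add: U_def)
  have pow0: "(\<lambda>k. q ^ k) \<longlonglongrightarrow> 0"
    using q0 q_less by (simp add: LIMSEQ_power_zero)
  have bound0: "(\<lambda>k. C * (q ^ k / (1 - q) * d)) \<longlonglongrightarrow> 0" for C
    using tendsto_mult_right[OF pow0, of "C * d / (1 - q)"] by (simp add: field_simps)

  have fixed: "\<Psi> t = f t (U t) (U (\<phi> t))" if t: "t \<in> {0..a}" for t
  proof (rule LIMSEQ_unique)
    show "(\<lambda>k. \<psi> (Suc k) t) \<longlonglongrightarrow> \<Psi> t"
      using tendsto_uniform_limitI[OF lim t] by (rule LIMSEQ_Suc)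
    have le: "norm (\<psi> (Suc k) t - f t (U t) (U (\<phi> t))) \<le> (L1 + L2) * M0 * (q ^ k / (1 - q) * d)" for k
      using f_diff[OF u_cont u_bound U_cont U_bound u_err t] psi_step[OF t]
      by (simp add: mult.assoc)
    show "(\<lambda>k. \<psi> (Suc k) t) \<longlonglongrightarrow> f t (U t) (U (\<phi> t))"
      by (rule LIM_zero_cancel[OF Lim_null_comparison[OF always_eventually[OF allI[OF le]] bound0]])
  qed

  have "solves_bvp a \<alpha> \<beta> \<gamma> b f \<phi> U"
    using repr(1)[OF Psi_cont] fixed by (simp add: U_def solves_linear_bvp_def solves_bvp_def)
  moreover have "w t = U t"
    if w: "solves_bvp a \<alpha> \<beta> \<gamma> b f \<phi> w" and w_bound: "\<forall>t\<in>{0..a}. \<bar>w t\<bar> \<le> ?r" and t: "t \<in> {0..a}"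
    for w t
  proof -
    let ?\<eta> = "\<lambda>t. f t (w t) (w (\<phi> t))"
    let ?e = "norm_C a (\<lambda>t. w t - U t)"
    have w_cont: "continuous_on {0..a} w"
      using w by (simp add: solves_bvp_def C3_on_imp_continuous_on)
    have w_bound: "\<bar>w t\<bar> \<le> ?r" if "t \<in> {0..a}" for t
      using w_bound that by blast
    note eta_cont = super(2)[OF w_cont w_bound]
    have "solves_linear_bvp a \<alpha> \<beta> \<gamma> b ?\<eta> w"
      using w by (simp add: solves_bvp_def solves_linear_bvp_def)
    then have w_T: "w t = ?T ?\<eta> t" if "t \<in> {0..a}" for t
      using repr(2)[OF eta_cont] that by blast
    have diff_le: "\<bar>w t - U t\<bar> \<le> ?e" if "t \<in> {0..a}" for t
      using abs_le_norm_C[OF continuous_on_diff[OF w_cont U_cont] that] .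
    have "\<bar>?\<eta> t - \<Psi> t\<bar> \<le> (L1 + L2) * ?e" if "t \<in> {0..a}" for t
      using f_diff[OF w_cont w_bound U_cont U_bound diff_le that] fixed[OF that] by simp
    from T_diff[OF eta_cont Psi_cont this]
    have "\<bar>w t - U t\<bar> \<le> q * ?e" if "t \<in> {0..a}" for t
      using that w_T[OF that] by (simp add: U_def q_eq mult.assoc mult.left_commute)
    then have "?e \<le> q * ?e"
      using a_pos by (intro norm_C_le) auto
    then have "(1 - q) * ?e \<le> 0"
      by (simp add: algebra_simps)
    then have "?e \<le> 0"
      using q_less by (simp add: mult_le_0_iff)
    with diff_le[OF t] show ?thesis by simp
  qed
  moreover have "uniform_limit {0..a} u U sequentially"
  proof (rule uniform_limitI)
    fix e :: real assume "e > 0"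
    then have "\<forall>\<^sub>F k in sequentially. M0 * (q ^ k / (1 - q) * d) < e"
      by (rule order_tendstoD(2)[OF bound0])
    then show "\<forall>\<^sub>F k in sequentially. \<forall>t\<in>{0..a}. dist (u k t) (U t) < e"
      by eventually_elim (use u_err le_less_trans in \<open>unfold dist_real_def, blast\<close>)
  qed
  moreover have "norm_C a (\<lambda>t. u k t - U t) \<le> M0 * (q ^ k / (1 - q)) * d" for k
    using u_err a_pos by (intro norm_C_le) (auto simp: mult.assoc)
  ultimately show ?thesis
    using U_bound by blast
qed

end
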